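(* Let $m\le n$, let $Q\in\mathbb{R}^{m\times n}$ satisfy $QQ^T=I$ and have sign pattern $S$, and let $B\in\mathbb{R}^{m\times n}$ be such that $BQ^T$ is skew-symmetric, with sign pattern $R=\operatorname{sgn}(B)$. If $X=O$ is the only $m\times m$ symmetric matrix satisfying $(XQ)\circ S_{\vec R}=O$, then every super pattern of $S_{\vec R}$ allows orthogonality.
   Context: All matrices are real; $\circ$ is the Hadamard product. A sign pattern is a $(0,1,-1)$-matrix; $\operatorname{sgn}(A)$ is the entrywise sign of $A$. An $m\times n$ sign pattern $T$ allows orthogonality if there is $Q'\in\mathbb{R}^{m\times n}$ with $Q'Q'^T=I$ and $\operatorname{sgn}(Q')=T$. For sign patterns $S=[s_{ij}]$, $R=[r_{ij}]$ of the same size, $S_{\vec R}$ is the sign pattern with $(i,j)$-entry $s_{ij}$ if $s_{ij}\neq0$ and $r_{ij}$ otherwise; a super pattern of $T$ is any sign pattern of the form $T_{\vec U}$. *)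

theory Defs
  imports "HOL-Analysis.Analysis"
begin

definition sign_pattern :: "real ^ 'n ^ 'm \<Rightarrow> bool" where
  "sign_pattern S \<longleftrightarrow> (\<forall>i j. S $ i $ j \<in> {0, 1, -1})"

(* The library's sgn at a vector type is normalisation x / norm x, hence the entrywise version. *)
definition sgn_mat :: "real ^ 'n ^ 'm \<Rightarrow> real ^ 'n ^ 'm" where
  "sgn_mat A = (\<chi> i j. sgn (A $ i $ j))"

(* Multiplication at vector types is componentwise, so at the type of matrices it is entrywise
   and differs from the matrix product. *)
abbreviation hadamard :: "real ^ 'n ^ 'm \<Rightarrow> real ^ 'n ^ 'm \<Rightarrow> real ^ 'n ^ 'm"
    (infixl "\<circ>\<^sub>H" 70) where
  "A \<circ>\<^sub>H B \<equiv> A * B"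

definition allows_orthogonality :: "real ^ 'n ^ 'm \<Rightarrow> bool" where
  "allows_orthogonality T \<longleftrightarrow>
     (\<exists>Q :: real ^ 'n ^ 'm. Q ** transpose Q = mat 1 \<and> sgn_mat Q = T)"

definition pattern_extend :: "real ^ 'n ^ 'm \<Rightarrow> real ^ 'n ^ 'm \<Rightarrow> real ^ 'n ^ 'm" where
  "pattern_extend S R = (\<chi> i j. if S $ i $ j \<noteq> 0 then S $ i $ j else R $ i $ j)"

definition super_pattern :: "real ^ 'n ^ 'm \<Rightarrow> real ^ 'n ^ 'm \<Rightarrow> bool" where
  "super_pattern P T \<longleftrightarrow> (\<exists>U. sign_pattern U \<and> P = pattern_extend T U)"

end

theory Submission
  imports Defs
begin

text \<open>
  Put \<open>M = pattern_extend S R\<close>. We look for an orthogonal matrix of the form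
  \<open>A = Q + t (B + t C + W)\<close>, where \<open>t > 0\<close> is small, \<open>C\<close> carries the new signs
  off the support of \<open>M\<close>, and \<open>W\<close> is small and supported on the support of \<open>M\<close>;
  such an \<open>A\<close> has the prescribed signs. Because \<open>B Q\<^sup>T\<close> is skew-symmetric,
  \<open>A A\<^sup>T = I\<close> amounts to \<open>W Q\<^sup>T + Q W\<^sup>T = - t (C Q\<^sup>T + Q C\<^sup>T + D D\<^sup>T)\<close>
  with \<open>D = B + t C + W\<close>. The hypothesis on symmetric \<open>X\<close> says that the adjoint of
  \<open>W \<mapsto> W Q\<^sup>T + Q W\<^sup>T\<close>, restricted to these \<open>W\<close>, is injective on symmetric
  matrices, so this map has a linear right inverse there. That turns the equation into a fixed
  point problem \<open>W = t H(t, W)\<close>, which Brouwer's theorem solves in any given ball once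
  \<open>t\<close> is small.
\<close>

lemma transpose_plus: "transpose (A + B) = transpose A + transpose B"
  by (simp add: transpose_def vec_eq_iff)

lemma transpose_diff: "transpose (A - B :: 'a::ab_group_add^'n^'m) = transpose A - transpose B"
  by (simp add: transpose_def vec_eq_iff)

lemma inner_transpose:
  fixes A B :: "real^'n^'m"
  shows "transpose A \<bullet> transpose B = A \<bullet> B"
  unfolding inner_vec_def transpose_def by (simp add: sum.swap[of _ "UNIV :: 'n set"])

text \<open>This adjointness links the hypothesis on \<open>X ** Q\<close> to the linearised
  orthogonality equation, whose terms have the form \<open>V ** transpose Q\<close>.\<close>

lemma inner_matrix_mult_transpose:
  fixes X :: "real^'k^'m" and V :: "real^'n^'m" and Q :: "real^'n^'k"
  shows "X \<bullet> (V ** transpose Q) = (X ** Q) \<bullet> V"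
proof -
  have "(\<Sum>k\<in>UNIV. X $ i $ k * (\<Sum>j\<in>UNIV. V $ i $ j * Q $ k $ j))
      = (\<Sum>j\<in>UNIV. (\<Sum>k\<in>UNIV. X $ i $ k * Q $ k $ j) * V $ i $ j)" for i
    unfolding sum_distrib_left sum_distrib_right
    by (subst sum.swap) (simp add: mult_ac)
  then show ?thesis
    by (simp add: inner_vec_def matrix_matrix_mult_def transpose_def)
qed

lemma inner_times_vec:
  fixes A M Z :: "real^'n^'m"
  shows "A \<bullet> (M * Z) = (M * A) \<bullet> Z"
  by (simp add: inner_vec_def mult_ac)

lemma bounded_bilinear_matrix_mult:
  "bounded_bilinear ((**) :: real^'k^'m \<Rightarrow> real^'n^'k \<Rightarrow> real^'n^'m)"
  unfolding bilinear_conv_bounded_bilinear[symmetric] bilinear_def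
  by (auto intro!: linearI simp: matrix_matrix_mult_def vec_eq_iff algebra_simps
      sum.distrib sum_distrib_left)

lemma bounded_linear_transpose:
  "bounded_linear (transpose :: real^'n^'m \<Rightarrow> real^'m^'n)"
  unfolding linear_conv_bounded_linear[symmetric]
  by (auto intro!: linearI simp: transpose_def vec_eq_iff)

text \<open>By compactness \<open>H\<close> is bounded by some \<open>K\<close> for \<open>t\<close>
  in [0, 1] and \<open>x\<close> in the ball. Once \<open>t < r / K\<close>, the scaled map sends
  the ball into itself and Brouwer's theorem applies.\<close>

lemma fixed_point_small_scaling:
  fixes H :: "real \<Rightarrow> 'a::euclidean_space \<Rightarrow> 'a"
  assumes cont: "continuous_on UNIV (\<lambda>(t, x). H t x)" and "r > 0"
  shows "\<forall>\<^sub>F t in at_right 0. \<exists>x\<in>cball 0 r. x = t *\<^sub>R H t x"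
proof -
  have "compact ((\<lambda>(t, x). H t x) ` ({0..1} \<times> cball 0 r))"
    by (intro compact_continuous_image compact_Times compact_cball compact_Icc
        continuous_on_subset[OF cont] subset_UNIV)
  from compact_imp_bounded[OF this] obtain K where "K > 0"
    and K: "\<And>t x. t \<in> {0..1} \<Longrightarrow> x \<in> cball 0 r \<Longrightarrow> norm (H t x) \<le> K"
    unfolding bounded_pos by fastforce
  have "\<exists>x\<in>cball 0 r. x = t *\<^sub>R H t x" if t: "0 < t" "t < min 1 (r / K)" for t
  proof -
    have "continuous_on (cball 0 r) (\<lambda>x. t *\<^sub>R (\<lambda>(t, x). H t x) (t, x))"
      by (intro continuous_intros continuous_on_compose2[OF cont]) auto
    then have cont_t: "continuous_on (cball 0 r) (\<lambda>x. t *\<^sub>R H t x)"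
      by simp
    have maps: "(\<lambda>x. t *\<^sub>R H t x) \<in> cball 0 r \<rightarrow> cball 0 r"
    proof
      fix x :: 'a assume "x \<in> cball 0 r"
      then have "t * norm (H t x) \<le> t * K" using t by (intro mult_left_mono K) auto
      also have "\<dots> \<le> r" using t \<open>K > 0\<close> by (simp add: field_simps)
      finally show "t *\<^sub>R H t x \<in> cball 0 r" using t by simp
    qed
    have "cball (0::'a) r \<noteq> {}" using \<open>r > 0\<close> by simp
    then obtain x where "x \<in> cball 0 r" "t *\<^sub>R H t x = x"
      by (rule brouwer[OF compact_cball convex_cball _ cont_t maps])
    then show ?thesis by (intro bexI[of _ x]) (rule sym)
  qed
  then show ?thesis
    unfolding eventually_at_right_field
    using \<open>r > 0\<close> \<open>K > 0\<close> by (intro exI[of _ "min 1 (r / K)"]) auto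
qed

lemma sgn_add_small:
  fixes a b :: real
  assumes "\<bar>b\<bar> < \<bar>a\<bar>"
  shows "sgn (a + b) = sgn a"
  using assms by (auto simp: sgn_if abs_if split: if_splits)

text \<open>As for a pseudo-inverse, the map is composed with its adjoint, weighted by
  \<open>M\<close> to enforce the support. On symmetric matrices the result is positive definite by
  \<open>inj\<close>, hence invertible.\<close>

lemma supported_right_inverse:
  fixes Q M :: "real^'n^'m"
  assumes inj: "\<And>X :: real^'m^'m. transpose X = X \<Longrightarrow> (X ** Q) * M = 0 \<Longrightarrow> X = 0"
  obtains L :: "real^'m^'m \<Rightarrow> real^'n^'m" where "linear L"
    and "\<And>Y i j. M $ i $ j = 0 \<Longrightarrow> L Y $ i $ j = 0"
    and "\<And>Y. transpose Y = Y \<Longrightarrow> L Y ** transpose Q + Q ** transpose (L Y) = Y"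
proof -
  \<comment> \<open>\<open>(X + transpose X) ** Q\<close> is the adjoint of \<open>K\<close> at
    \<open>X\<close>. The factor \<open>M\<close> occurs twice so that pairing
    \<open>K (V X)\<close> with a matrix built from \<open>X\<close> can give a squared
    norm.\<close>
  define V where "V = (\<lambda>X :: real^'m^'m. M * (M * ((X + transpose X) ** Q)))"
  define K where "K = (\<lambda>W :: real^'n^'m. W ** transpose Q + Q ** transpose W)"
  \<comment> \<open>The skew part of \<open>X\<close> is added to make the map injective on all square matrices.\<close>
  define N where "N = (\<lambda>X. K (V X) + (X - transpose X))"
  note lin_tr = bounded_linear.linear[OF bounded_linear_transpose]
  note bil = bounded_bilinear_matrix_mult
  have lin_M: "linear (\<lambda>Z. M * Z)"
    by (auto intro!: linearI simp: vec_eq_iff algebra_simps)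
  have "linear (\<lambda>X :: real^'m^'m. (X + transpose X) ** Q)"
    using linear_compose[OF linear_compose_add[OF linear_ident lin_tr]
        bounded_linear.linear[OF bounded_bilinear.bounded_linear_left[OF bil]]]
    by (simp add: o_def)
  from linear_compose[OF linear_compose[OF this lin_M] lin_M]
  have lin_V: "linear V" by (simp add: V_def o_def)
  have lin_K: "linear K"
    unfolding K_def
    using linear_compose_add[OF
        bounded_linear.linear[OF bounded_bilinear.bounded_linear_left[OF bil]]
        linear_compose[OF lin_tr
          bounded_linear.linear[OF bounded_bilinear.bounded_linear_right[OF bil]]]]
    by (simp add: o_def)
  have lin_N: "linear N"
    unfolding N_def
    using linear_compose_add[OF linear_compose[OF lin_V lin_K]
        linear_compose_sub[OF linear_ident lin_tr]]
    by (simp add: o_def)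
  have sym_K: "transpose (K W) = K W" for W
    by (simp add: K_def transpose_plus matrix_transpose_mul add.commute)
  \<comment> \<open>\<open>K (V X)\<close> is symmetric, so a symmetric \<open>N X\<close> makes the
    skew term equal to its own negative. Hence \<open>g\<close> below preserves symmetry, and the
    skew term drops out there.\<close>
  have sym_N: "transpose X = X" if "transpose (N X) = N X" for X
  proof -
    have "K (V X) + (transpose X - X) = K (V X) + (X - transpose X)"
      using that by (simp add: N_def transpose_plus transpose_diff sym_K)
    then have "2 *\<^sub>R X = 2 *\<^sub>R transpose X"
      by (simp add: scaleR_2 algebra_simps)
    then show ?thesis by simp
  qed
  have "inj N"
    unfolding linear_injective_0[OF lin_N]
  proof (intro allI impI)
    fix X assume N0: "N X = 0"
    then have "transpose (N X) = N X" by (simp add: transpose_def vec_eq_iff)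
    then have X: "transpose X = X" by (rule sym_N)
    define Y where "Y = X + transpose X"
    have symY: "transpose Y = Y" by (simp add: Y_def transpose_plus add.commute)
    \<comment> \<open>Pairing \<open>Y\<close> with \<open>K (V X)\<close> gives twice this squared
      norm, so \<open>K (V X) = 0\<close> forces \<open>Y ** Q\<close> to vanish on the support of
      \<open>M\<close>.\<close>
    have "Y \<bullet> (V X ** transpose Q) = (M * (Y ** Q)) \<bullet> (M * (Y ** Q))"
      by (simp add: inner_matrix_mult_transpose V_def Y_def[symmetric] inner_times_vec)
    moreover have "Y \<bullet> (Q ** transpose (V X)) = Y \<bullet> (V X ** transpose Q)"
      using inner_transpose[of Y "V X ** transpose Q"]
      by (simp add: symY matrix_transpose_mul)
    moreover have "K (V X) = 0" using N0 X by (simp add: N_def)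
    ultimately have "(M * (Y ** Q)) \<bullet> (M * (Y ** Q)) = 0"
      by (metis K_def double_zero inner_add_right inner_zero_right)
    then have "(Y ** Q) * M = 0" by (simp add: mult.commute)
    then have "Y = 0" using inj symY by blast
    then have "2 *\<^sub>R X = 0" using X by (simp add: Y_def scaleR_2)
    then show "X = 0" by simp
  qed
  then obtain g where "linear g" and g: "N \<circ> g = id"
    using linear_injective_imp_surjective[OF lin_N] linear_surjective_right_inverse[OF lin_N]
    by metis
  show ?thesis
  proof (rule that[of "V \<circ> g"])
    show "linear (V \<circ> g)" using \<open>linear g\<close> lin_V by (rule linear_compose)
    show "(V \<circ> g) Y $ i $ j = 0" if "M $ i $ j = 0" for Y i j
      using that by (simp add: V_def)
    fix Y :: "real^'m^'m" assume Y: "transpose Y = Y"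
    have Ng: "N (g Y) = Y" using fun_cong[OF g, of Y] by simp
    then have "transpose (g Y) = g Y" using Y by (simp add: sym_N)
    then show "(V \<circ> g) Y ** transpose Q + Q ** transpose ((V \<circ> g) Y) = Y"
      using Ng by (simp add: N_def K_def)
  qed
qed

text \<open>In the linear term \<open>B\<close> cancels by skewness, and \<open>W\<close> is chosen
  to absorb both \<open>C\<close> and the quadratic term exactly. The condition is implicit, since
  \<open>D\<close> contains \<open>W\<close>.\<close>

lemma orthogonal_perturbation:
  fixes Q B C W :: "real^'n^'m" and t :: real
  defines "D \<equiv> B + t *\<^sub>R C + W"
  assumes Q: "Q ** transpose Q = mat 1"
    and B: "B ** transpose Q + Q ** transpose B = 0"
    and W: "W ** transpose Q + Q ** transpose W
          = t *\<^sub>R (- (C ** transpose Q + Q ** transpose C + D ** transpose D))"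
  shows "(Q + t *\<^sub>R D) ** transpose (Q + t *\<^sub>R D) = mat 1"
proof -
  note bil = bounded_bilinear_matrix_mult
  note dist = bounded_bilinear.add_left[OF bil] bounded_bilinear.add_right[OF bil]
    bounded_bilinear.scaleR_left[OF bil] bounded_bilinear.scaleR_right[OF bil]
    transpose_plus transpose_scalar
  have "D ** transpose Q + Q ** transpose D
      = (B ** transpose Q + Q ** transpose B) + t *\<^sub>R (C ** transpose Q + Q ** transpose C)
        + (W ** transpose Q + Q ** transpose W)"
    by (simp add: D_def dist scaleR_add_right)
  also have "\<dots> = - t *\<^sub>R (D ** transpose D)"
    unfolding B W by (simp add: algebra_simps)
  finally have D: "D ** transpose Q + Q ** transpose D = - t *\<^sub>R (D ** transpose D)" .
  have "(Q + t *\<^sub>R D) ** transpose (Q + t *\<^sub>R D)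
      = Q ** transpose Q + t *\<^sub>R (D ** transpose Q + Q ** transpose D)
        + t *\<^sub>R t *\<^sub>R (D ** transpose D)"
    by (simp add: dist scaleR_add_right)
  also have "\<dots> = mat 1" by (simp add: D Q)
  finally show ?thesis .
qed

theorem theorem6p8:
  fixes Q B S R :: "real ^ 'n ^ 'm"
  assumes "CARD('m) \<le> CARD('n)"
    and "Q ** transpose Q = mat 1"
    and "S = sgn_mat Q"
    and "transpose (B ** transpose Q) = - (B ** transpose Q)"
    and "R = sgn_mat B"
    and "\<forall>X :: real ^ 'm ^ 'm.
           transpose X = X \<and> (X ** Q) \<circ>\<^sub>H pattern_extend S R = 0 \<longrightarrow> X = 0"
  shows "\<forall>P. super_pattern P (pattern_extend S R) \<longrightarrow> allows_orthogonality P"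
proof (intro allI impI)
  fix P assume "super_pattern P (pattern_extend S R)"
  then obtain U where U: "sign_pattern U" and P: "P = pattern_extend (pattern_extend S R) U"
    by (auto simp: super_pattern_def)
  define M where "M = pattern_extend S R"
  have M: "M $ i $ j = (if Q $ i $ j \<noteq> 0 then sgn (Q $ i $ j) else sgn (B $ i $ j))" for i j
    by (simp add: M_def pattern_extend_def assms(3,5) sgn_mat_def sgn_zero_iff)
  have P_M: "P $ i $ j = (if M $ i $ j \<noteq> 0 then M $ i $ j else U $ i $ j)" for i j
    by (simp add: P M_def pattern_extend_def)
  \<comment> \<open>Where \<open>M\<close> vanishes, so do \<open>Q\<close>, \<open>B\<close> and
    the later \<open>W\<close>; the final entry there is exactly
    \<open>t * t * U $ i $ j\<close>.\<close>
  define C :: "real^'n^'m" where "C = (\<chi> i j. if M $ i $ j = 0 then U $ i $ j else 0)"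
  obtain L :: "real^'m^'m \<Rightarrow> real^'n^'m" where "linear L"
    and L0: "\<And>Y i j. M $ i $ j = 0 \<Longrightarrow> L Y $ i $ j = 0"
    and L: "\<And>Y. transpose Y = Y \<Longrightarrow> L Y ** transpose Q + Q ** transpose (L Y) = Y"
    using supported_right_inverse[of Q M] assms(6) unfolding M_def by blast
  \<comment> \<open>The radius must lie below every nonzero \<open>|B $ i $ j|\<close>. Choosing it
    by a filter avoids a minimum over a possibly empty set.\<close>
  have "\<forall>\<^sub>F r in at_right (0::real). \<forall>i j. B $ i $ j \<noteq> 0 \<longrightarrow> r < \<bar>B $ i $ j\<bar>"
  proof (intro eventually_all_finite)
    fix i j
    show "\<forall>\<^sub>F r in at_right (0::real). B $ i $ j \<noteq> 0 \<longrightarrow> r < \<bar>B $ i $ j\<bar>"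
      using order_tendstoD(2)[OF tendsto_ident_at, of 0 "\<bar>B $ i $ j\<bar>"]
      by (cases "B $ i $ j = 0") auto
  qed
  with eventually_at_right_less[of "0::real"]
  have "\<forall>\<^sub>F r in at_right (0::real). 0 < r \<and> (\<forall>i j. B $ i $ j \<noteq> 0 \<longrightarrow> r < \<bar>B $ i $ j\<bar>)"
    by (rule eventually_conj)
  then obtain r :: real where "r > 0" and r: "\<And>i j. B $ i $ j \<noteq> 0 \<Longrightarrow> r < \<bar>B $ i $ j\<bar>"
    using eventually_happens'[OF trivial_limit_at_right_real] by blast
  define D where "D = (\<lambda>t W. B + t *\<^sub>R C + W)"
  \<comment> \<open>\<open>t *\<^sub>R E t W\<close> is the required value of
    \<open>W ** transpose Q + Q ** transpose W\<close>, so a fixed point of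
    \<open>t *\<^sub>R L (E t W)\<close> solves the equation.\<close>
  define E where
    "E = (\<lambda>t W. - (C ** transpose Q + Q ** transpose C + D t W ** transpose (D t W)))"
  note cont_mult = bounded_bilinear.continuous_on[OF bounded_bilinear_matrix_mult]
  note cont_tr = bounded_linear.continuous_on[OF bounded_linear_transpose]
  have "bounded_linear L" using \<open>linear L\<close> by (simp add: linear_conv_bounded_linear)
  note cont_L = bounded_linear.continuous_on[OF this]
  have "continuous_on UNIV (\<lambda>(t, W). L (E t W))"
    unfolding case_prod_unfold E_def D_def
    by (intro cont_L cont_mult cont_tr continuous_intros)
  from fixed_point_small_scaling[OF this \<open>r > 0\<close>]
  have fp: "\<forall>\<^sub>F t in at_right 0. \<exists>W\<in>cball 0 r. W = t *\<^sub>R L (E t W)" .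
  \<comment> \<open>For \<open>0 < t < 1\<close> and \<open>W\<close> in the ball, the bracket
    bounds \<open>|D t W $ i $ j|\<close>, so the perturbation cannot flip a nonzero entry of
    \<open>Q\<close>.\<close>
  have Qsmall: "\<forall>\<^sub>F t in at_right (0::real). \<forall>i j. Q $ i $ j \<noteq> 0 \<longrightarrow>
      t * (\<bar>B $ i $ j\<bar> + \<bar>C $ i $ j\<bar> + r) < \<bar>Q $ i $ j\<bar>"
  proof (intro eventually_all_finite)
    fix i j
    have "((\<lambda>t. t * (\<bar>B $ i $ j\<bar> + \<bar>C $ i $ j\<bar> + r)) \<longlongrightarrow> 0) (at_right 0)"
      by (intro tendsto_mult_left_zero tendsto_ident_at)
    from order_tendstoD(2)[OF this, of "\<bar>Q $ i $ j\<bar>"]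
    show "\<forall>\<^sub>F t in at_right (0::real). Q $ i $ j \<noteq> 0 \<longrightarrow>
        t * (\<bar>B $ i $ j\<bar> + \<bar>C $ i $ j\<bar> + r) < \<bar>Q $ i $ j\<bar>"
      by (cases "Q $ i $ j = 0") auto
  qed
  have "\<forall>\<^sub>F t in at_right (0::real). t < 1"
    by (intro order_tendstoD(2)[OF tendsto_ident_at]) simp
  with fp Qsmall eventually_at_right_less[of "0::real"]
  have "\<forall>\<^sub>F t in at_right (0::real). 0 < t \<and> t < 1 \<and> (\<exists>W\<in>cball 0 r. W = t *\<^sub>R L (E t W)) \<and>
      (\<forall>i j. Q $ i $ j \<noteq> 0 \<longrightarrow> t * (\<bar>B $ i $ j\<bar> + \<bar>C $ i $ j\<bar> + r) < \<bar>Q $ i $ j\<bar>)"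
    by eventually_elim blast
  then obtain t W where t: "0 < t" "t < 1" and "W \<in> cball 0 r" and W: "W = t *\<^sub>R L (E t W)"
    and tQ: "\<And>i j. Q $ i $ j \<noteq> 0 \<Longrightarrow> t * (\<bar>B $ i $ j\<bar> + \<bar>C $ i $ j\<bar> + r) < \<bar>Q $ i $ j\<bar>"
    using eventually_happens'[OF trivial_limit_at_right_real] by blast
  have W_r: "\<bar>W $ i $ j\<bar> \<le> r" for i j
    using \<open>W \<in> cball 0 r\<close>
      order_trans[OF component_le_norm_cart Finite_Cartesian_Product.norm_nth_le, of W i j]
    by simp
  have W0: "W $ i $ j = 0" if "M $ i $ j = 0" for i j
    by (subst W) (simp add: L0 that)
  have symE: "transpose (E t W) = E t W"
  proof -
    have "transpose (- A) = - transpose A" for A :: "real^'m^'m"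
      by (simp add: transpose_def vec_eq_iff)
    then show ?thesis
      by (simp add: E_def transpose_plus transpose_diff matrix_transpose_mul algebra_simps)
  qed
  let ?A = "Q + t *\<^sub>R D t W"
  have "W ** transpose Q + Q ** transpose W
      = t *\<^sub>R (L (E t W) ** transpose Q + Q ** transpose (L (E t W)))"
    by (subst (1 2) W) (simp add: transpose_scalar scaleR_add_right
        bounded_bilinear.scaleR_left[OF bounded_bilinear_matrix_mult]
        bounded_bilinear.scaleR_right[OF bounded_bilinear_matrix_mult])
  also have "\<dots> = t *\<^sub>R E t W" by (simp add: L symE)
  finally have W_eq: "W ** transpose Q + Q ** transpose W = t *\<^sub>R E t W" .
  have "B ** transpose Q + Q ** transpose B = 0"
    using assms(4) by (simp add: matrix_transpose_mul)
  from orthogonal_perturbation[OF assms(2) this W_eq[unfolded E_def D_def]]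
  have "?A ** transpose ?A = mat 1" by (simp only: D_def)
  moreover have "sgn_mat ?A = P"
  proof -
    have "sgn (?A $ i $ j) = P $ i $ j" for i j
    proof (cases "Q $ i $ j = 0")
      case False
      have "t * \<bar>C $ i $ j\<bar> \<le> \<bar>C $ i $ j\<bar>"
        using t by (intro mult_left_le_one_le) auto
      then have "\<bar>D t W $ i $ j\<bar> \<le> \<bar>B $ i $ j\<bar> + \<bar>C $ i $ j\<bar> + r"
        using W_r[of i j] abs_mult[of t "C $ i $ j"] t by (simp add: D_def)
      then have "t * \<bar>D t W $ i $ j\<bar> \<le> t * (\<bar>B $ i $ j\<bar> + \<bar>C $ i $ j\<bar> + r)"
        using t by (intro mult_left_mono) auto
      also note tQ[OF False]
      finally have "\<bar>t * D t W $ i $ j\<bar> < \<bar>Q $ i $ j\<bar>"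
        using t by (simp add: abs_mult)
      then show ?thesis
        using False by (simp add: sgn_add_small P_M M sgn_zero_iff)
    next
      case Q0: True
      show ?thesis
      proof (cases "B $ i $ j = 0")
        case False
        \<comment> \<open>Here \<open>M\<close> is nonzero, so \<open>C\<close> vanishes and the
          entry of \<open>?A\<close> is \<open>t * (B $ i $ j + W $ i $ j)\<close>.\<close>
        have "sgn (B $ i $ j + W $ i $ j) = sgn (B $ i $ j)"
          using r[OF False] W_r[of i j] by (intro sgn_add_small) linarith
        then show ?thesis
          using False Q0 t
          by (simp add: P_M M sgn_zero_iff D_def C_def sgn_mult)
      next
        case True
        have "sgn (U $ i $ j) = U $ i $ j"
          using U unfolding sign_pattern_def by (metis insertE singletonD sgn_0 sgn_1 sgn_minus)
        then show ?thesis
          using True Q0 t W0[of i j]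
          by (simp add: P_M M D_def C_def sgn_mult)
      qed
    qed
    then show ?thesis by (simp add: sgn_mat_def vec_eq_iff)
  qed
  ultimately show "allows_orthogonality P"
    unfolding allows_orthogonality_def by blast
qed

end
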